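(* Let $n\ge4$ and let $w$ be a $cd$-monomial with $m$ occurrences of the variable $d$. Then: (1) if $\deg(w)=n-1$, then $[wc]\check\Phi^n_0\ge 2^m$; (2) if $n\ge5$, $1\le j\le n-1$ and $\deg(w)=n-2$, then $[wd]\check\Phi^n_j\ge 2^m$.
   Context: $cd$-monomials are words in non-commuting variables $c,d$ with $\deg c=1$, $\deg d=2$; $[w]p$ denotes the coefficient of the monomial $w$ in the polynomial $p$. The polynomials $\check\Phi^n_i$: let $\Lambda^n$ be the boundary complex of an $n$-simplex with facets $\sigma_0,\dots,\sigma_n$; for $0\le i\le n-1$ let $\Gamma^n_i$ be the simplicial complex generated by $\sigma_0,\dots,\sigma_i$, and $\Lambda^n_i$ the regular CW complex obtained from $\Gamma^n_i$ by attaching one new $(n-1)$-cell $\tau$ with $\partial\tau=\partial\Gamma^n_i$. For such a CW sphere $\Lambda$, $\Phi_\Lambda$ is the $cd$-index of its face poset $Q$ with $\hat0,\hat1$ adjoined (Eulerian of rank $n+1$): the unique polynomial with $\Phi_Q(a+b,ab+ba)=\sum_{S\subseteq[n]}h_S(Q)u_S$, where $h_S(Q)=\sum_{T\subseteq S}(-1)^{|S\setminus T|}f_T(Q)$, $f_T(Q)$ is the number of chains $\hat0<x_1<\dots<x_k<\hat1$ whose rank set is $T$, and $u_S=u_1\cdots u_n$ with $u_i=b$ if $i\in S$, $a$ otherwise. Set $\check\Phi^n_0=\Phi_{\Lambda^n_0}$, $\check\Phi^n_i=\Phi_{\Lambda^n_i}-\Phi_{\Lambda^n_{i-1}}$ for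 $1\le i\le n-1$, $\check\Phi^n_n=0$. *)

theory Defs
  imports Main
begin

datatype abvar = Av | Bv
datatype cdvar = Cv | Dv

definition cd_deg :: "cdvar list \<Rightarrow> nat" where
  "cd_deg w = sum_list (map (\<lambda>x. case x of Cv \<Rightarrow> 1 | Dv \<Rightarrow> 2) w)"

definition num_d :: "cdvar list \<Rightarrow> nat" where
  "num_d w = length (filter (\<lambda>x. x = Dv) w)"

text \<open>The set of ab-words occurring (each with coefficient 1) in the expansion of the
  cd-monomial w under c := a+b, d := ab+ba.\<close>
fun expand :: "cdvar list \<Rightarrow> abvar list set" where
  "expand [] = {[]}"
| "expand (Cv # w) = {x # v | x v. v \<in> expand w}"
| "expand (Dv # w) = {[Av, Bv] @ v | v. v \<in> expand w} \<union> {[Bv, Av] @ v | v. v \<in> expand w}"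

text \<open>The cd-index of an ab-polynomial psi (given by its coefficient function):
  the unique cd-polynomial phi (finitely supported coefficient function) with
  phi(a+b, ab+ba) = psi.\<close>
definition cd_index :: "(abvar list \<Rightarrow> int) \<Rightarrow> (cdvar list \<Rightarrow> int)" where
  "cd_index psi = (THE phi. finite {w. phi w \<noteq> 0} \<and>
      (\<forall>v. psi v = (\<Sum>w\<in>{w. phi w \<noteq> 0 \<and> v \<in> expand w}. phi w)))"

definition flagf :: "'a set \<Rightarrow> ('a \<Rightarrow> 'a \<Rightarrow> bool) \<Rightarrow> ('a \<Rightarrow> nat) \<Rightarrow> 'a \<Rightarrow> 'a \<Rightarrow> nat set \<Rightarrow> nat" where
  "flagf P le rk zer one T =
     card {C. C \<subseteq> P - {zer, one} \<and> (\<forall>x\<in>C. \<forall>y\<in>C. le x y \<or> le y x) \<and> rk ` C = T}"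

definition flagh :: "'a set \<Rightarrow> ('a \<Rightarrow> 'a \<Rightarrow> bool) \<Rightarrow> ('a \<Rightarrow> nat) \<Rightarrow> 'a \<Rightarrow> 'a \<Rightarrow> nat set \<Rightarrow> int" where
  "flagh P le rk zer one S =
     (\<Sum>T\<in>Pow S. (-1) ^ card (S - T) * int (flagf P le rk zer one T))"

text \<open>ab-index of a poset of rank n+1: sum over S of h_S u_S, with u_S = u_1...u_n,
  u_i = b if i in S, a otherwise.\<close>
definition abindex :: "nat \<Rightarrow> (nat set \<Rightarrow> int) \<Rightarrow> abvar list \<Rightarrow> int" where
  "abindex n h v = (if length v = n then h {i \<in> {1..n}. v ! (i - 1) = Bv} else 0)"

datatype cell = Bot | Face "nat set" | Tau | Top

text \<open>Facet sigma_k of the boundary of the n-simplex on vertex set {0..n}.\<close>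
definition sigma :: "nat \<Rightarrow> nat \<Rightarrow> nat set" where
  "sigma n k = {0..n} - {k}"

definition gamma_faces :: "nat \<Rightarrow> nat \<Rightarrow> nat set set" where
  "gamma_faces n i = {F. F \<noteq> {} \<and> (\<exists>k\<le>i. F \<subseteq> sigma n k)}"

text \<open>Faces of the boundary of the pure (n-1)-dimensional complex Gamma^n_i: faces contained
  in some (n-2)-face (ridge) lying in exactly one facet of Gamma^n_i.\<close>
definition boundary_faces :: "nat \<Rightarrow> nat \<Rightarrow> nat set set" where
  "boundary_faces n i = {F \<in> gamma_faces n i. \<exists>R\<in>gamma_faces n i. F \<subseteq> R \<and> card R = n - 1 \<and>
        card {k. k \<le> i \<and> R \<subseteq> sigma n k} = 1}"

text \<open>Face poset of Lambda^n_i with hat0 = Bot and hat1 = Top adjoined; Tau is the new cell.\<close>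
definition lam_carrier :: "nat \<Rightarrow> nat \<Rightarrow> cell set" where
  "lam_carrier n i = {Bot, Tau, Top} \<union> Face ` gamma_faces n i"

definition lam_le :: "nat \<Rightarrow> nat \<Rightarrow> cell \<Rightarrow> cell \<Rightarrow> bool" where
  "lam_le n i x y = (x = Bot \<or> y = Top \<or> x = y \<or>
      (\<exists>F G. x = Face F \<and> y = Face G \<and> F \<subseteq> G) \<or>
      (\<exists>F. x = Face F \<and> y = Tau \<and> F \<in> boundary_faces n i))"

definition lam_rk :: "nat \<Rightarrow> cell \<Rightarrow> nat" where
  "lam_rk n x = (case x of Bot \<Rightarrow> 0 | Face F \<Rightarrow> card F | Tau \<Rightarrow> n | Top \<Rightarrow> n + 1)"

definition Phi_Lambda :: "nat \<Rightarrow> nat \<Rightarrow> cdvar list \<Rightarrow> int" where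
  "Phi_Lambda n i = cd_index (abindex n
      (flagh (lam_carrier n i) (lam_le n i) (lam_rk n) Bot Top))"

definition checkPhi :: "nat \<Rightarrow> nat \<Rightarrow> cdvar list \<Rightarrow> int" where
  "checkPhi n i w = (if i = 0 then Phi_Lambda n 0 w
      else if i \<le> n - 1 then Phi_Lambda n i w - Phi_Lambda n (i - 1) w
      else 0)"

end

theory Submission
  imports Defs
begin

text \<open>Write \<open>\<Phi>\<close>-check \<open>(n, i) = P(n, i) c + Q(n, i) d\<close>. A chain of faces with rank set \<open>T\<close> is
  determined by its top face and a chain below it, and the number of the latter depends only on \<open>T\<close>.
  Hence the flag vectors of the spheres are linear combinations of binomial coefficients in
  \<open>max T\<close>, and Pascal's rule gives the recursion
    \<open>P(n, i) = \<Sum>k=i..<n. \<Phi>\<close>-check \<open>(n - 1, k)\<close> and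
    \<open>Q(n, i) = \<Sum>k<i. P(n - 1, k) - P(n - 1, n - 1 - k)\<close>.
  Inductively all coefficients are nonnegative, so \<open>P(n, i)\<close> decreases in \<open>i\<close> down to \<open>P(n, n) = 0\<close>.
  The summands of \<open>Q\<close> are antisymmetric under \<open>k \<mapsto> n - 1 - k\<close> and nonnegative in the first half,
  hence \<open>Q(n, i) \<ge> Q(n, 1) = P(n - 1, 0)\<close> for \<open>1 \<le> i \<le> n - 1\<close>. So the second claim follows from the
  first in dimension \<open>n - 1\<close>, and in \<open>P(n, 0)\<close> a final \<open>d\<close> collects at least two summands
  \<open>Q(n - 1, k) \<ge> P(n - 2, 0)\<close>, which yields the factor 2.\<close>

section \<open>Uniqueness of the cd-index\<close>

abbreviation cdwords :: "abvar list \<Rightarrow> cdvar list set" where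
  "cdwords v \<equiv> {w. v \<in> expand w}"

lemma cdwords_Nil: "cdwords [] = {[]}"
proof -
  have "w = []" if "[] \<in> expand w" for w
    using that by (cases w rule: expand.cases) auto
  then show ?thesis by auto
qed

text \<open>A leading c accounts for one letter of the ab-word; a leading d accounts for two, which
  must then differ.\<close>

lemma cdwords_Cons:
  "cdwords (x # v) = Cons Cv ` cdwords v \<union>
     (case v of [] \<Rightarrow> {} | y # u \<Rightarrow> if y \<noteq> x then Cons Dv ` cdwords u else {})"
  (is "?L = ?R")
proof -
  have "x # v \<in> expand w \<longleftrightarrow> w \<in> ?R" for w
  proof (cases w rule: expand.cases)
    case (3 w')
    then show ?thesis by (cases v; cases x; cases "hd v") auto
  qed (auto split: list.splits)
  then show ?thesis by blast
qed

lemma finite_cdwords: "finite (cdwords v)"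
proof (induction v rule: length_induct)
  case (1 v)
  show ?case
  proof (cases v)
    case Nil
    then show ?thesis by (simp only: cdwords_Nil finite.intros)
  next
    case (Cons x u)
    with 1 show ?thesis
      unfolding Cons cdwords_Cons by (cases u) auto
  qed
qed

lemma sum_cdwords_Cons:
  fixes f :: "cdvar list \<Rightarrow> int"
  shows "sum f (cdwords (x # v)) = (\<Sum>w\<in>cdwords v. f (Cv # w)) +
     (case v of [] \<Rightarrow> 0 | y # u \<Rightarrow> if y \<noteq> x then \<Sum>w\<in>cdwords u. f (Dv # w) else 0)"
proof -
  have "sum f (cdwords (x # v)) = sum f (Cons Cv ` cdwords v) +
     sum f (case v of [] \<Rightarrow> {} | y # u \<Rightarrow> if y \<noteq> x then Cons Dv ` cdwords u else {})"
    unfolding cdwords_Cons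
    by (rule sum.union_disjoint) (use finite_cdwords in \<open>auto split: list.splits if_splits\<close>)
  then show ?thesis
    by (auto simp: sum.reindex split: list.splits)
qed

text \<open>Suitable prefixes separate the cd-words starting with c from those starting with d, so
  the hypothesis passes to the coefficients of the shorter words.\<close>

lemma cd_expansion_inj:
  fixes f :: "cdvar list \<Rightarrow> int"
  assumes "\<And>v. sum f (cdwords v) = 0"
  shows "f w = 0"
  using assms
proof (induction w arbitrary: f)
  case Nil
  from Nil[of "[]"] show ?case by (simp add: cdwords_Nil del: mem_Collect_eq)
next
  case (Cons x w)
  have C: "(\<Sum>w\<in>cdwords v. f (Cv # w)) = 0" for v
  proof (cases v)
    case Nil
    with Cons.prems[of "[Av]"] show ?thesis by (simp add: sum_cdwords_Cons)
  next
    case (Cons y u)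
    \<comment> \<open>Doubling the first letter excludes a leading d, so only the words starting
      with c contribute.\<close>
    with Cons.prems[of "y # v"] show ?thesis by (simp add: sum_cdwords_Cons[of f y "y # u"])
  qed
  \<comment> \<open>With two distinct leading letters both kinds occur, and the part starting with c
    vanishes by \<open>C\<close>.\<close>
  have D: "(\<Sum>w\<in>cdwords u. f (Dv # w)) = 0" for u
    using Cons.prems[of "Av # Bv # u"] C[of "Bv # u"]
    by (simp add: sum_cdwords_Cons[of f Av])
  show ?case
    using Cons.IH[of "\<lambda>w. f (Cv # w)"] Cons.IH[of "\<lambda>w. f (Dv # w)"] C D by (cases x) auto
qed

lemma cd_index_eqI:
  assumes fin: "finite {w. phi w \<noteq> 0}"
    and psi: "\<And>v. psi v = sum phi (cdwords v)"
  shows "cd_index psi = phi"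
proof -
  \<comment> \<open>Only finitely many cd-words expand to a given ab-word, so adding those with
    coefficient zero leaves the sum unchanged.\<close>
  have eq: "(\<Sum>w\<in>{w. f w \<noteq> 0 \<and> v \<in> expand w}. f w) = sum f (cdwords v)"
    for f :: "cdvar list \<Rightarrow> int" and v
    by (rule sum.mono_neutral_left) (use finite_cdwords in auto)
  show ?thesis unfolding cd_index_def eq
  proof (rule the_equality)
    fix f assume f: "finite {w. f w \<noteq> 0} \<and> (\<forall>v. psi v = sum f (cdwords v))"
    have "f w - phi w = 0" for w
      by (rule cd_expansion_inj[where f = "\<lambda>w. f w - phi w"])
        (use f psi in \<open>simp add: sum_subtractf\<close>)
    then show "f = phi" by (auto simp: fun_eq_iff)
  qed (use assms in auto)
qed

section \<open>Reversal and degree of words\<close>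

lemma expand_append: "u \<in> expand x \<Longrightarrow> v \<in> expand y \<Longrightarrow> u @ v \<in> expand (x @ y)"
  by (induction x arbitrary: u rule: expand.induct) fastforce+

lemma expand_rev: "v \<in> expand w \<Longrightarrow> rev v \<in> expand (rev w)"
proof (induction w arbitrary: v rule: expand.induct)
  case (2 w)
  then show ?case using expand_append[of _ "rev w" "[_]" "[Cv]"] by fastforce
next
  case (3 w)
  then show ?case
    using expand_append[of _ "rev w" "[Av, Bv]" "[Dv]"] expand_append[of _ "rev w" "[Bv, Av]" "[Dv]"]
    by fastforce
qed auto

lemma cdwords_rev: "cdwords (rev v) = rev ` cdwords v"
  using expand_rev expand_rev[of "rev v"] by (force simp: image_iff)

lemma length_expand: "v \<in> expand w \<Longrightarrow> length v = cd_deg w"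
  by (induction w arbitrary: v rule: expand.induct) (auto simp: cd_deg_def)

lemma cd_deg_simps [simp]:
  "cd_deg [] = 0" "cd_deg (Cv # w) = Suc (cd_deg w)" "cd_deg (Dv # w) = Suc (Suc (cd_deg w))"
  "cd_deg (rev w) = cd_deg w"
  by (auto simp: cd_deg_def rev_map[symmetric])

lemma num_d_simps [simp]:
  "num_d [] = 0" "num_d (Cv # w) = num_d w" "num_d (Dv # w) = Suc (num_d w)"
  "num_d (rev w) = num_d w"
  by (auto simp: num_d_def rev_filter[symmetric])

lemma finite_cd_deg: "finite {w. cd_deg w = n}"
proof (induction n rule: less_induct)
  case (less n)
  have "{w. cd_deg w = n} \<subseteq> insert [] (\<Union>m<n. Cons Cv ` {w. cd_deg w = m} \<union> Cons Dv ` {w. cd_deg w = m})"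
  proof
    fix w assume "w \<in> {w. cd_deg w = n}"
    then show "w \<in> insert [] (\<Union>m<n. Cons Cv ` {w. cd_deg w = m} \<union> Cons Dv ` {w. cd_deg w = m})"
      by (cases w rule: expand.cases) auto
  qed
  then show ?case by (rule finite_subset) (use less in auto)
qed

section \<open>Alternating sums over descent sets\<close>

text \<open>The set S of the monomial u_S for a reversed word: the head of the list is the last
  letter, so its position is the length of the list.\<close>

fun bset :: "abvar list \<Rightarrow> nat set" where
  "bset [] = {}"
| "bset (x # r) = (if x = Bv then insert (Suc (length r)) (bset r) else bset r)"

lemma bset_subset: "bset r \<subseteq> {1..length r}"
  by (induction r) auto

lemma finite_bset [simp]: "finite (bset r)"
  using bset_subset finite_subset by blast

lemma bset_rev: "{i \<in> {1..length v}. v ! (i - 1) = Bv} = bset (rev v)"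
proof (induction v rule: rev_induct)
  case (snoc x v)
  have "{i \<in> {1..length (v @ [x])}. (v @ [x]) ! (i - 1) = Bv} =
     {i \<in> {1..length v}. v ! (i - 1) = Bv} \<union> (if x = Bv then {Suc (length v)} else {})"
    by (auto simp: nth_append le_Suc_eq)
  then show ?case using snoc by simp
qed auto

section \<open>Chains of faces with a given rank set\<close>

text \<open>Ranks are cardinalities. The family may contain the empty face and so be closed under
  subsets; a rank set without 0 keeps that face out of the chains.\<close>

definition chains :: "nat set set \<Rightarrow> nat set \<Rightarrow> nat set set set" where
  "chains X T = {C. C \<subseteq> X \<and> (\<forall>F\<in>C. \<forall>G\<in>C. F \<subseteq> G \<or> G \<subseteq> F) \<and> card ` C = T}"

lemma chainsD:
  assumes "C \<in> chains X T"
  shows "C \<subseteq> X" "F \<in> C \<Longrightarrow> G \<in> C \<Longrightarrow> F \<subseteq> G \<or> G \<subseteq> F" "card ` C = T"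
  using assms by (auto simp: chains_def)

text \<open>With the value 0 for the empty rank set, the empty chain obeys the same counting formula
  as the others, with the empty face as its top.\<close>

definition mx :: "nat set \<Rightarrow> nat" where
  "mx T = (if T = {} then 0 else Max T)"

text \<open>The number of ways to extend a fixed top face of size \<open>mx T\<close> downwards to a
  chain with rank set \<open>T\<close>; the set \<open>{..<mx T}\<close> serves as the model of that
  face.\<close>

definition below_count :: "nat set \<Rightarrow> nat" where
  "below_count T = card (chains (Pow {..<mx T}) (T - {mx T}))"

lemma mx_insert: "finite T \<Longrightarrow> (\<And>t. t \<in> T \<Longrightarrow> t < s) \<Longrightarrow> mx (insert s T) = s"
  by (simp add: mx_def, rule Max_eqI) (auto intro: less_imp_le)

lemma chains_empty: "chains X {} = {{}}"
  by (auto simp: chains_def)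

lemma finite_chains: "finite X \<Longrightarrow> finite (chains X T)"
  by (rule finite_subset[of _ "Pow X"]) (auto simp: chains_def)

text \<open>A member comparable with the top face \<open>F\<close> and of no larger size lies inside
  \<open>F\<close>, so removing \<open>F\<close> leaves a chain in \<open>Pow F\<close>.\<close>

lemma chains_top:
  assumes X: "\<And>F G. F \<in> X \<Longrightarrow> G \<subseteq> F \<Longrightarrow> G \<in> X" "\<And>F. F \<in> X \<Longrightarrow> finite F"
    and t: "t \<in> T" "\<And>s. s \<in> T \<Longrightarrow> s \<le> t"
  shows "chains X T = (\<Union>F\<in>{F\<in>X. card F = t}. insert F ` chains (Pow F) (T - {t}))"
proof (intro equalityI subsetI)
  fix C assume C: "C \<in> chains X T"
  then obtain F where F: "F \<in> C" "card F = t" using t by (auto simp: chains_def)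
  have sub: "G \<subseteq> F \<and> card G \<noteq> t" if "G \<in> C - {F}" for G
  proof -
    have "G \<subseteq> F \<or> F \<subseteq> G" "card G \<le> t" "finite F" "finite G"
      using that C F t X(2) by (auto simp: chains_def)
    with F that show ?thesis
      by (metis DiffD2 card_seteq insertI1)
  qed
  have "C - {F} \<in> chains (Pow F) (T - {t})"
    using C F sub unfolding chains_def by blast
  moreover have "C = insert F (C - {F})" "F \<in> X" using F C by (auto simp: chains_def)
  ultimately show "C \<in> (\<Union>F\<in>{F\<in>X. card F = t}. insert F ` chains (Pow F) (T - {t}))"
    using F by blast
next
  fix C assume "C \<in> (\<Union>F\<in>{F\<in>X. card F = t}. insert F ` chains (Pow F) (T - {t}))"
  then obtain F D where *: "F \<in> X" "card F = t" "C = insert F D" "D \<in> chains (Pow F) (T - {t})"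
    by blast
  then show "C \<in> chains X T"
    using t(1) X(1)[OF *(1)] unfolding chains_def by auto
qed

text \<open>Induction on \<^term>\<open>T\<close> for the second claim: the chains below a fixed top face \<^term>\<open>F\<close> are counted
  by the same formula, so their number depends only on \<^term>\<open>card F\<close>.\<close>
lemma card_chains:
  assumes "finite T" "0 \<notin> T" "finite X" "{} \<in> X"
    and "\<And>F G. F \<in> X \<Longrightarrow> G \<subseteq> F \<Longrightarrow> G \<in> X" "\<And>F. F \<in> X \<Longrightarrow> finite F"
  shows "card (chains X T) = below_count T * card {F \<in> X. card F = mx T}"
  using assms
proof (induction "card T" arbitrary: T X rule: less_induct)
  case less
  show ?case
  proof (cases "T = {}")
    case True
    have "{F \<in> X. card F = 0} = {{}}" using less.prems by auto
    then show ?thesis by (simp add: True chains_empty below_count_def mx_def)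
  next
    case False
    define t where "t = mx T"
    have t: "t \<in> T" "\<And>s. s \<in> T \<Longrightarrow> s \<le> t"
      using False less.prems by (auto simp: t_def mx_def)
    define S where "S = T - {t}"
    have S: "card S < card T" "finite S" "0 \<notin> S"
      using t less.prems card_Diff1_less[of T t] by (auto simp: S_def simp del: card_Diff_singleton)
    have Pow: "card (chains (Pow F) S) = below_count S * (t choose mx S)"
      if "finite F" "card F = t" for F
    proof -
      have "card {G \<in> Pow F. card G = mx S} = t choose mx S"
        using n_subsets[OF that(1), of "mx S"] that by simp
      moreover have "card (chains (Pow F) S) = below_count S * card {G \<in> Pow F. card G = mx S}"
        by (rule less.hyps[OF S]) (use that(1) in \<open>auto intro: finite_subset[of _ F]\<close>)
      ultimately show ?thesis by simp
    qed
    have bc: "below_count T = below_count S * (t choose mx S)"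
      using Pow[of "{..<t}"] by (simp add: below_count_def[of T] t_def[symmetric] S_def)
    \<comment> \<open>No member of the lower chain has size \<open>t\<close>. Hence the top face can
      be read off from the chain, which makes the insertion injective and the union
      disjoint.\<close>
    have nin: "F \<notin> C" if "C \<in> chains (Pow F) S" "card F = t" for F C
      using that by (auto simp: chains_def S_def)
    have nin': "F \<notin> C" if "C \<in> chains (Pow G) S" "card F = t" for F G C
      using that by (auto simp: chains_def S_def)
    have "chains X T = (\<Union>F\<in>{F\<in>X. card F = t}. insert F ` chains (Pow F) S)"
      unfolding S_def by (rule chains_top[OF less.prems(5,6) t])
    moreover have "card (\<Union>F\<in>{F\<in>X. card F = t}. insert F ` chains (Pow F) S) =
        (\<Sum>F\<in>{F\<in>X. card F = t}. card (insert F ` chains (Pow F) S))"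
    proof (rule card_UN_disjoint)
      show "\<forall>F\<in>{F \<in> X. card F = t}. finite (insert F ` chains (Pow F) S)"
        using less.prems by (auto intro!: finite_chains)
      show "\<forall>F\<in>{F \<in> X. card F = t}. \<forall>G\<in>{F \<in> X. card F = t}. F \<noteq> G \<longrightarrow>
         insert F ` chains (Pow F) S \<inter> insert G ` chains (Pow G) S = {}"
        using nin' by fastforce
    qed (use less.prems in auto)
    ultimately have "card (chains X T) = (\<Sum>F\<in>{F\<in>X. card F = t}. card (insert F ` chains (Pow F) S))"
      by simp
    also have "\<dots> = (\<Sum>F\<in>{F\<in>X. card F = t}. below_count T)"
    proof (rule sum.cong)
      fix F assume F: "F \<in> {F \<in> X. card F = t}"
      have "inj_on (insert F) (chains (Pow F) S)"
        using nin F by (intro inj_onI) (metis (mono_tags, lifting) insert_ident mem_Collect_eq)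
      then show "card (insert F ` chains (Pow F) S) = below_count T"
        using F Pow[of F] less.prems by (simp add: card_image bc)
    qed simp
    finally show ?thesis by (simp add: t_def)
  qed
qed

lemma below_count_insert:
  assumes "finite T" "0 \<notin> T" "\<And>t. t \<in> T \<Longrightarrow> t < s"
  shows "below_count (insert s T) = below_count T * (s choose mx T)"
proof -
  have "insert s T - {s} = T" using assms(3) by blast
  then have "below_count (insert s T) = card (chains (Pow {..<s}) T)"
    by (simp add: below_count_def mx_insert assms)
  also have "\<dots> = below_count T * card {F \<in> Pow {..<s}. card F = mx T}"
    by (rule card_chains[OF assms(1,2)]) (auto intro: finite_subset[of _ "{..<s}"])
  also have "card {F \<in> Pow {..<s}. card F = mx T} = s choose mx T"
    using n_subsets[of "{..<s}" "mx T"] by simp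
  finally show ?thesis .
qed

lemma below_count_empty: "below_count {} = 1"
  by (simp add: below_count_def chains_empty)

section \<open>Binomial counts and Pascal's rule\<close>

text \<open>The number of \<open>t\<close>-sets between a fixed \<open>i\<close>-set and an
  \<open>n\<close>-set containing it. The guard matters because truncated subtraction would give 1
  for \<open>t < i\<close>.\<close>

definition over :: "nat \<Rightarrow> nat \<Rightarrow> nat \<Rightarrow> int" where
  "over n i t = (if i \<le> t then int ((n - i) choose (t - i)) else 0)"

lemma card_over:
  assumes "finite A" "B \<subseteq> A"
  shows "int (card {F. F \<subseteq> A \<and> B \<subseteq> F \<and> card F = t}) = over (card A) (card B) t"
proof (cases "card B \<le> t")
  case True
  have fB: "finite B" using assms finite_subset by blast
  have "{F. F \<subseteq> A \<and> B \<subseteq> F \<and> card F = t} = (\<lambda>G. G \<union> B) ` {G. G \<subseteq> A - B \<and> card G = t - card B}"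
    (is "?L = ?f ` ?R")
  proof (intro equalityI subsetI)
    fix F assume F: "F \<in> ?L"
    then have "F - B \<in> ?R" "F = ?f (F - B)" using fB by (auto simp: card_Diff_subset)
    then show "F \<in> ?f ` ?R" by blast
  next
    fix F assume "F \<in> ?f ` ?R"
    then obtain G where G: "F = G \<union> B" "G \<subseteq> A - B" "card G = t - card B" by blast
    then have "card F = card G + card B"
      using fB assms by (metis Diff_disjoint Int_commute card_Un_disjoint disjoint_iff finite_Diff finite_subset subsetD)
    then show "F \<in> ?L" using G True assms by auto
  qed
  moreover have "inj_on ?f ?R" by (rule inj_onI) blast
  ultimately have "card ?L = card ?R" by (simp add: card_image)
  also have "\<dots> = (card A - card B) choose (t - card B)"
    using assms fB by (simp add: n_subsets card_Diff_subset)
  finally show ?thesis using True by (simp add: over_def)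
next
  case False
  then have "{F. F \<subseteq> A \<and> B \<subseteq> F \<and> card F = t} = {}"
    using assms by (auto dest: card_mono[rotated] intro: finite_subset)
  with False show ?thesis by (simp only: over_def card.empty) simp
qed

lemma over_0: "over n 0 t = int (n choose t)"
  by (simp add: over_def)

text \<open>Single out one of the elements outside the fixed \<open>i\<close>-set: the first summand
  counts the sets that avoid it, the second those that contain it.\<close>

lemma over_pascal:
  assumes "i \<le> n"
  shows "over (Suc n) i t = over n i t + over (Suc n) (Suc i) t"
proof (cases "i < t")
  case True
  then obtain d where d: "t = Suc (i + d)" using less_natE by auto
  obtain e where e: "n = i + e" using assms le_Suc_ex by blast
  show ?thesis by (simp add: over_def d e Suc_diff_le)
qed (auto simp: over_def)

lemma over_telescope:
  assumes "i \<le> j" "j \<le> Suc n"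
  shows "over (Suc n) i t = (\<Sum>k=i..<j. over n k t) + over (Suc n) j t"
  using assms
proof (induction j rule: dec_induct)
  case (step j)
  then show ?case using over_pascal[of j n t] by simp
qed simp

text \<open>Telescoping all the way up leaves \<open>over (Suc n) (Suc n) t\<close>, which is 0 for
  \<open>t \<le> n\<close>.\<close>

lemma over_sum:
  assumes "i \<le> Suc n" "t \<le> n"
  shows "over (Suc n) i t = (\<Sum>k=i..<Suc n. over n k t)"
  using over_telescope[of i "Suc n" n t] assms by (simp add: over_def)

text \<open>The passage from flag f-numbers to flag h-numbers for counts of the shape
  \<open>below_count T * g (mx T)\<close>; the point is that it is linear in
  \<open>g\<close>.\<close>

definition altsum :: "nat set \<Rightarrow> (nat \<Rightarrow> int) \<Rightarrow> int" where
  "altsum S g = (\<Sum>T\<in>Pow S. (- 1) ^ card (S - T) * (int (below_count T) * g (mx T)))"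

lemma altsum_cong: "(\<And>T. T \<subseteq> S \<Longrightarrow> g (mx T) = h (mx T)) \<Longrightarrow> altsum S g = altsum S h"
  unfolding altsum_def by (intro sum.cong) auto

lemma altsum_sum: "altsum S (\<lambda>t. \<Sum>k\<in>K. g k t) = (\<Sum>k\<in>K. altsum S (g k))"
  unfolding altsum_def sum_distrib_left by (subst sum.swap) simp

lemma altsum_diff: "altsum S (\<lambda>t. g t - h t) = altsum S g - altsum S h"
  unfolding altsum_def by (simp add: sum_subtractf[symmetric] algebra_simps)

lemma altsum_mult: "altsum S (\<lambda>t. c * g t) = c * altsum S g"
  unfolding altsum_def by (simp add: sum_distrib_left algebra_simps)

text \<open>Pair each \<open>T\<close> without \<open>s\<close> with \<open>insert s T\<close>; the
  first has one more element in its complement, hence the opposite sign.\<close>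

lemma alternating_sum_insert:
  fixes f :: "nat set \<Rightarrow> int"
  assumes "finite S" "s \<notin> S"
  shows "(\<Sum>T\<in>Pow (insert s S). (- 1) ^ card (insert s S - T) * f T) =
     (\<Sum>T\<in>Pow S. (- 1) ^ card (S - T) * (f (insert s T) - f T))"
proof -
  have "(\<Sum>T\<in>Pow (insert s S). (- 1) ^ card (insert s S - T) * f T) =
     (\<Sum>T\<in>Pow S. (- 1) ^ card (insert s S - T) * f T) +
     (\<Sum>T\<in>insert s ` Pow S. (- 1) ^ card (insert s S - T) * f T)"
    unfolding Pow_insert using assms by (intro sum.union_disjoint) auto
  also have "(\<Sum>T\<in>insert s ` Pow S. (- 1) ^ card (insert s S - T) * f T) =
     (\<Sum>T\<in>Pow S. (- 1) ^ card (insert s S - insert s T) * f (insert s T))"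
    by (subst sum.reindex) (use assms in \<open>auto intro!: inj_onI\<close>)
  also have "\<dots> = (\<Sum>T\<in>Pow S. (- 1) ^ card (S - T) * f (insert s T))"
    using assms by (intro sum.cong refl arg_cong2[where f = "(*)"] arg_cong2[where f = "(^)"] arg_cong[where f = card]) auto
  also have "(\<Sum>T\<in>Pow S. (- 1) ^ card (insert s S - T) * f T) =
     (\<Sum>T\<in>Pow S. - ((- 1) ^ card (S - T) * f T))"
  proof (intro sum.cong refl)
    fix T assume "T \<in> Pow S"
    then have "insert s S - T = insert s (S - T)" "s \<notin> S - T" "finite (S - T)" using assms by auto
    then show "(- 1) ^ card (insert s S - T) * f T = - ((- 1) ^ card (S - T) * f T)" by simp
  qed
  finally show ?thesis by (simp add: sum.distrib[symmetric] algebra_simps)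
qed

text \<open>With \<open>n = length r + 1\<close>, \<open>desc r i\<close> is the coefficient of \<open>rev r\<close> followed by \<open>a\<close> in
  \<open>\<Phi>\<close>-check \<open>n\<close>, \<open>i\<close>, expanded in \<open>a\<close> and \<open>b\<close>.\<close>
definition desc :: "abvar list \<Rightarrow> nat \<Rightarrow> int" where
  "desc r i = altsum (bset r) (over (Suc (length r)) i)"

lemma mx_le: "T \<subseteq> bset r \<Longrightarrow> mx T \<le> length r"
  using bset_subset[of r] finite_subset[OF _ finite_bset[of r]] by (auto simp: mx_def)

lemma desc_Nil: "desc [] i = (if i = 0 then 1 else 0)"
  by (simp add: desc_def altsum_def below_count_empty mx_def over_def)

text \<open>A final a leaves the set \<open>bset\<close> unchanged and only raises the length, so
  \<open>over_sum\<close> applies inside the alternating sum.\<close>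

lemma desc_A:
  assumes "i \<le> Suc (Suc (length r))"
  shows "desc (Av # r) i = (\<Sum>k=i..<Suc (Suc (length r)). desc r k)"
proof -
  have "desc (Av # r) i = altsum (bset r) (\<lambda>t. \<Sum>k=i..<Suc (Suc (length r)). over (Suc (length r)) k t)"
    unfolding desc_def using assms mx_le[of _ r]
    by (auto intro!: altsum_cong over_sum simp: le_SucI simp del: sum.op_ivl_Suc)
  then show ?thesis by (simp add: altsum_sum desc_def del: sum.op_ivl_Suc)
qed

text \<open>A final b adds a new largest rank. A chain with that rank contributes a factor
  \<open>over n 0\<close> below its top, and the chains without it are subtracted and expanded by
  \<open>over_sum\<close>.\<close>

lemma desc_B:
  assumes i: "i \<le> Suc (Suc (length r))"
  shows "desc (Bv # r) i = (\<Sum>k=i..<Suc (Suc (length r)). desc r 0 - desc r k)"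
proof -
  let ?n = "Suc (length r)" and ?S = "bset r"
  have S: "finite ?S" "?n \<notin> ?S" using bset_subset[of r] by auto
  have ins: "below_count (insert ?n T) = below_count T * (?n choose mx T)" "mx (insert ?n T) = ?n"
    if "T \<subseteq> ?S" for T
  proof -
    have "finite T" "0 \<notin> T" "\<And>t. t \<in> T \<Longrightarrow> t < ?n"
      using that bset_subset[of r] by (force intro: finite_subset[OF _ finite_bset[of r]])+
    then show "below_count (insert ?n T) = below_count T * (?n choose mx T)" "mx (insert ?n T) = ?n"
      using below_count_insert mx_insert by auto
  qed
  \<comment> \<open>A set of size one less than the whole omits exactly one of the elements outside
    the fixed \<open>i\<close>-set.\<close>
  have top: "over (Suc ?n) i ?n = int (Suc ?n - i)"
    using i by (auto simp: over_def le_Suc_eq Suc_diff_le)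
  have "desc (Bv # r) i = (\<Sum>T\<in>Pow ?S. (- 1) ^ card (?S - T) *
     (int (below_count (insert ?n T)) * over (Suc ?n) i (mx (insert ?n T)) -
      int (below_count T) * over (Suc ?n) i (mx T)))"
    unfolding desc_def altsum_def by (simp add: alternating_sum_insert S)
  also have "\<dots> = altsum ?S (\<lambda>t. int (Suc ?n - i) * over ?n 0 t - over (Suc ?n) i t)"
    unfolding altsum_def by (intro sum.cong) (auto simp: ins top over_0 algebra_simps)
  also have "\<dots> = altsum ?S (\<lambda>t. int (Suc ?n - i) * over ?n 0 t - (\<Sum>k=i..<Suc ?n. over ?n k t))"
    using i mx_le[of _ r] by (intro altsum_cong arg_cong2[where f = "(-)"] refl over_sum) (auto intro: le_SucI)
  also have "\<dots> = int (Suc ?n - i) * desc r 0 - (\<Sum>k=i..<Suc ?n. desc r k)"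
    by (simp add: altsum_diff altsum_mult altsum_sum desc_def del: sum.op_ivl_Suc)
  finally show ?thesis by (simp add: sum_subtractf del: sum.op_ivl_Suc)
qed

section \<open>Coefficients\<close>

text \<open>\<open>coef x n i\<close> is the coefficient of \<open>rev x\<close> in \<open>\<Phi>\<close>-check \<open>n\<close>, \<open>i\<close>; words are reversed because
  the recursion removes the last letter.\<close>
primrec coef :: "cdvar list \<Rightarrow> nat \<Rightarrow> nat \<Rightarrow> int" where
  "coef [] n i = (if n = 0 \<and> i = 0 then 1 else 0)"
| "coef (y # x) n i = (case y of
     Cv \<Rightarrow> \<Sum>k=i..<n. coef x (n - 1) k
   | Dv \<Rightarrow> \<Sum>k<i. (\<Sum>j=k..<n - 1. coef x (n - 2) j) - (\<Sum>j=n - 1 - k..<n - 1. coef x (n - 2) j))"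

lemma coef_deg: "coef x n i \<noteq> 0 \<Longrightarrow> cd_deg x = n"
proof (induction x arbitrary: n i)
  case (Cons y x)
  show ?case
  proof (cases y)
    case Cv
    with Cons.prems obtain k where "k \<in> {i..<n}" "coef x (n - 1) k \<noteq> 0"
      by (metis (no_types, lifting) coef.simps(2) cdvar.simps(3) sum.neutral)
    then show ?thesis using Cons.IH[of "n - 1" k] Cv by simp
  next
    case Dv
    show ?thesis
    proof (rule ccontr)
      assume "cd_deg (y # x) \<noteq> n"
      then have "coef x (n - 2) j = 0" if "j < n - 1" for j
        using Cons.IH[of "n - 2" j] that Dv by fastforce
      with Cons.prems Dv show False by simp
    qed
  qed
qed (auto split: if_splits)

section \<open>Expanding the coefficients in a and b\<close>

text \<open>The coefficient of \<open>rev v\<close> after substituting a + b and ab + ba into the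
  cd-polynomial with coefficients \<open>coef\<close>.\<close>

definition ab_coef :: "abvar list \<Rightarrow> nat \<Rightarrow> nat \<Rightarrow> int" where
  "ab_coef v n i = (\<Sum>x\<in>cdwords v. coef x n i)"

lemma ab_coef_Cons:
  "ab_coef (x # v) n i = (\<Sum>k=i..<n. ab_coef v (n - 1) k) +
    (case v of [] \<Rightarrow> 0 | y # u \<Rightarrow> if y \<noteq> x then \<Sum>k<i. (\<Sum>j=k..<n - 1. ab_coef u (n - 2) j) -
       (\<Sum>j=n - 1 - k..<n - 1. ab_coef u (n - 2) j) else 0)"
proof -
  have sw: "(\<Sum>w\<in>cdwords v. \<Sum>k\<in>K. f w k) = (\<Sum>k\<in>K. \<Sum>w\<in>cdwords v. f w k)"
    for v K and f :: "cdvar list \<Rightarrow> nat \<Rightarrow> int" by (rule sum.swap)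
  show ?thesis
    unfolding ab_coef_def sum_cdwords_Cons
    by (simp add: sw sum_subtractf del: mem_Collect_eq split: list.splits)
qed

lemma ab_coef_Nil: "ab_coef [] n i = (if n = 0 \<and> i = 0 then 1 else 0)"
  by (simp add: ab_coef_def cdwords_Nil del: mem_Collect_eq)

lemma sum_rev_interval:
  fixes f :: "nat \<Rightarrow> int"
  assumes "i \<le> n"
  shows "(\<Sum>k=n - i..<n. f k) = (\<Sum>k<i. f (n - 1 - k))"
  by (rule sum.reindex_bij_witness[of _ "\<lambda>k. n - 1 - k" "\<lambda>k. n - 1 - k"]) (use assms in auto)

lemma sum_tail:
  fixes f :: "nat \<Rightarrow> int"
  assumes "i \<le> n"
  shows "(\<Sum>k=i..<n. f k) = (\<Sum>k=0..<n. f k) - (\<Sum>k<i. f k)"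
  using sum.atLeastLessThan_concat[of 0 i n f] assms by (simp add: lessThan_atLeast0)

text \<open>Both letters go through one induction: prepending an equal letter involves only the
  recursion for c, and prepending the other letter adds the term for d, which by \<open>G\<close> is
  a sum of differences of \<open>desc\<close>.\<close>

lemma ab_coef_desc:
  "\<And>i. i \<le> Suc (length v) \<Longrightarrow> ab_coef (Av # v) (Suc (length v)) i = desc v i"
  "\<And>i. i \<le> Suc (length v) \<Longrightarrow>
     ab_coef (Bv # v) (Suc (length v)) i = desc v 0 - desc v (Suc (length v) - i)"
proof (induction v)
  case Nil
  {
    case 1
    then show ?case by (auto simp: ab_coef_Cons ab_coef_Nil desc_Nil le_Suc_eq)
  next
    case 2
    then show ?case by (auto simp: ab_coef_Cons ab_coef_Nil desc_Nil le_Suc_eq)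
  }
next
  case (Cons y u)
  let ?N = "Suc (length u)"
  let ?G = "\<lambda>k. \<Sum>j=k..<?N. ab_coef u (?N - 1) j"
  text \<open>\<open>?G\<close> is the value at a word obtained by doubling the first letter of \<open>u\<close>; both
    induction hypotheses give the same antisymmetric part.\<close>
  have G: "?G k - ?G (?N - k) = desc u k - desc u (?N - k)" if "k \<le> ?N" for k
  proof -
    obtain z where z: "\<And>k. ab_coef (z # u) ?N k = ?G k"
    proof (cases u)
      case Nil
      then show ?thesis using that[of Av] by (simp add: ab_coef_Cons)
    next
      case (Cons z u')
      have "ab_coef (z # u) ?N k = ?G k" for k
        by (subst ab_coef_Cons) (simp add: Cons del: sum.op_ivl_Suc)
      then show ?thesis by (rule that)
    qed
    show ?thesis
      using Cons.IH(1)[of k] Cons.IH(1)[of "?N - k"] Cons.IH(2)[of k] Cons.IH(2)[of "?N - k"] that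
      unfolding z[symmetric] by (cases z) simp_all
  qed
  have D: "(\<Sum>k<i. ?G k - ?G (?N - k)) = (\<Sum>k<i. desc u k - desc u (?N - k))" if "i \<le> Suc ?N" for i
    by (rule sum.cong) (use that G in auto)
  have R: "ab_coef (x # y # u) (Suc ?N) i = (\<Sum>k=i..<Suc ?N. ab_coef (y # u) ?N k) +
      (if y \<noteq> x then \<Sum>k<i. desc u k - desc u (?N - k) else 0)" if "i \<le> Suc ?N" for i x
    using D[OF that] by (subst ab_coef_Cons) (simp del: sum.op_ivl_Suc)
  have A: "(\<Sum>k=i..<Suc ?N. ab_coef (Av # u) ?N k) = desc (Av # u) i" if "i \<le> Suc ?N" for i
    unfolding desc_A[OF that] using Cons.IH(1) by (intro sum.cong) auto
  have B: "(\<Sum>k=i..<Suc ?N. ab_coef (Bv # u) ?N k) = desc (Bv # u) 0 - desc (Bv # u) (Suc ?N - i)"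
    if "i \<le> Suc ?N" for i
  proof -
    have "(\<Sum>k=i..<Suc ?N. ab_coef (Bv # u) ?N k) = (\<Sum>k=i..<Suc ?N. desc u 0 - desc u (?N - k))"
      using Cons.IH(2) by (intro sum.cong) auto
    also have "\<dots> = (\<Sum>k<Suc ?N - i. desc u 0 - desc u k)"
      by (rule sum.reindex_bij_witness[of _ "\<lambda>k. ?N - k" "\<lambda>k. ?N - k"]) (use that in auto)
    also have "\<dots> = desc (Bv # u) 0 - desc (Bv # u) (Suc ?N - i)"
      by (subst (1 2) desc_B) (auto simp: sum_tail[of "Suc ?N - i"] simp del: sum.op_ivl_Suc)
    finally show ?thesis .
  qed
  have R1: "(\<Sum>k=Suc ?N - i..<Suc ?N. f k) = (\<Sum>k<i. f (?N - k))" if "i \<le> Suc ?N"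
    for i and f :: "nat \<Rightarrow> int"
    using sum_rev_interval[OF that, of f] by simp
  {
    case 1
    show ?case
    proof (cases y)
      case Av
      then show ?thesis using 1 R A by simp
    next
      case Bv
      have "ab_coef (Av # y # u) (Suc ?N) i = desc (Bv # u) 0 - desc (Bv # u) (Suc ?N - i) +
          (\<Sum>k<i. desc u k - desc u (?N - k))"
        using 1 R[of i Av] B[of i] Bv by (simp del: sum.op_ivl_Suc)
      \<comment> \<open>By \<open>desc_B\<close>, the first two terms form the full sum without its
        last \<open>i\<close> summands; the differences exchange these for the first
        \<open>i\<close> ones, leaving the sum that starts at \<open>i\<close>.\<close>
      also have "\<dots> = desc (Bv # u) i"
        using 1 by (simp add: desc_B R1 sum_tail[of i] sum_subtractf of_nat_diff algebra_simps del: sum.op_ivl_Suc)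
      finally show ?thesis using Bv by simp
    qed
  next
    case 2
    show ?case
    proof (cases y)
      case Bv
      then show ?thesis using 2 R B by simp
    next
      case Av
      have "ab_coef (Bv # y # u) (Suc ?N) i = desc (Av # u) i + (\<Sum>k<i. desc u k - desc u (?N - k))"
        using 2 R[of i Bv] A[of i] Av by (simp del: sum.op_ivl_Suc)
      also have "\<dots> = desc (Av # u) 0 - desc (Av # u) (Suc ?N - i)"
        using 2 by (simp add: desc_A R1 sum_tail[of i] sum_subtractf del: sum.op_ivl_Suc)
      finally show ?thesis using Av by simp
    qed
  }
qed


section \<open>Antisymmetric sums, nonnegativity and the lower bound\<close>

text \<open>The summands change sign under the reflection of k to N - k, so the total over all k up
  to N is 0 and each tail is minus the reflected initial sum.\<close>

lemma antisym_sum_flip: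
  fixes P :: "nat \<Rightarrow> int"
  assumes "i \<le> Suc N"
  shows "(\<Sum>k<i. P k - P (N - k)) = (\<Sum>k<Suc N - i. P k - P (N - k))"
proof -
  let ?t = "\<lambda>k. P k - P (N - k)"
  have flip: "(\<Sum>k=j..<Suc N. ?t k) = - (\<Sum>k<Suc N - j. ?t k)" if "j \<le> Suc N" for j
    unfolding sum_negf[symmetric]
    by (rule sum.reindex_bij_witness[of _ "\<lambda>k. N - k" "\<lambda>k. N - k"]) (use that in auto)
  have "(\<Sum>k=0..<Suc N. ?t k) = 0" using flip[of 0] by (simp add: atLeast0LessThan)
  then show ?thesis using flip[OF assms] sum_tail[OF assms, of ?t] by simp
qed

lemma antisym_sum_ge:
  fixes P :: "nat \<Rightarrow> int"
  assumes anti: "\<And>j k. j \<le> k \<Longrightarrow> k \<le> N \<Longrightarrow> P k \<le> P j" and i: "1 \<le> i" "i \<le> N"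
  shows "P 0 - P N \<le> (\<Sum>k<i. P k - P (N - k))"
proof -
  \<comment> \<open>In this range every \<open>k < i\<close> satisfies \<open>k \<le> N - k\<close>,
    so all summands are nonnegative and the one at 0 is a lower bound; larger \<open>i\<close> are
    reflected into this range.\<close>
  have small: "P 0 - P N \<le> (\<Sum>k<i. P k - P (N - k))" if "1 \<le> i" "2 * i \<le> N + 2" for i
  proof -
    have "P 0 - P (N - 0) \<le> (\<Sum>k<i. P k - P (N - k))"
      by (rule member_le_sum[of 0 _ "\<lambda>k. P k - P (N - k)"]) (use that anti in auto)
    then show ?thesis by simp
  qed
  show ?thesis
  proof (cases "2 * i \<le> N + 2")
    case False
    have "(\<Sum>k<i. P k - P (N - k)) = (\<Sum>k<Suc N - i. P k - P (N - k))"
      using antisym_sum_flip[of i N P] i by simp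
    then show ?thesis using small[of "Suc N - i"] False i by simp
  qed (use small i in auto)
qed

text \<open>The P(n, k) of the overview: the coefficient of \<open>rev x\<close> followed by
  c.\<close>

definition partial :: "cdvar list \<Rightarrow> nat \<Rightarrow> nat \<Rightarrow> int" where
  "partial x n k = (\<Sum>j=k..<n. coef x (n - 1) j)"

lemma coef_D: "coef (Dv # x) n i = (\<Sum>k<i. partial x (n - 1) k - partial x (n - 1) (n - 1 - k))"
  by (simp add: partial_def numeral_2_eq_2)

lemma partial_antimono:
  assumes "\<And>j. j < n \<Longrightarrow> 0 \<le> coef x (n - 1) j" "j \<le> k"
  shows "partial x n k \<le> partial x n j"
  unfolding partial_def by (rule sum_mono2) (use assms in auto)

text \<open>This is \<open>antisym_sum_ge\<close> with N = n - 1; the subtracted end value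
  \<open>partial x (n - 1) (n - 1)\<close> is an empty sum.\<close>

lemma coef_D_ge:
  assumes "\<And>j. j < n - 1 \<Longrightarrow> 0 \<le> coef x (n - 2) j" "1 \<le> i" "i < n"
  shows "partial x (n - 1) 0 \<le> coef (Dv # x) n i"
proof -
  have "partial x (n - 1) 0 - partial x (n - 1) (n - 1) \<le> coef (Dv # x) n i"
    unfolding coef_D
    by (rule antisym_sum_ge, rule partial_antimono) (use assms in \<open>auto simp: numeral_2_eq_2\<close>)
  then show ?thesis by (simp add: partial_def)
qed

lemma partial_nonneg:
  assumes "\<And>j. j < n \<Longrightarrow> 0 \<le> coef x (n - 1) j"
  shows "0 \<le> partial x n k"
  unfolding partial_def by (rule sum_nonneg) (use assms in auto)

lemma coef_nonneg: "i \<le> n \<Longrightarrow> 0 \<le> coef x n i"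
proof (induction x arbitrary: n i)
  case (Cons y x)
  show ?case
  proof (cases y)
    case Cv
    then show ?thesis using Cons.IH by (auto intro!: sum_nonneg)
  next
    case Dv
    consider "i = 0" | "i = n" "0 < n" | "1 \<le> i" "i < n" using Cons.prems by linarith
    then show ?thesis
    proof cases
      case 2
      then show ?thesis
        \<comment> \<open>For \<open>i = n\<close> the sum runs over the whole antisymmetric range,
          and its reflection is empty.\<close>
        using antisym_sum_flip[of n "n - 1" "partial x (n - 1)"] Dv by (simp only: coef_D) simp
    next
      case 3
      have "0 \<le> partial x (n - 1) 0"
        by (rule partial_nonneg) (use Cons.IH in auto)
      also have "\<dots> \<le> coef (y # x) n i"
        unfolding Dv by (rule coef_D_ge) (use Cons.IH 3 in auto)
      finally show ?thesis .
    qed (simp add: Dv)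
  qed
qed auto

lemma cd_deg_0_iff [simp]: "cd_deg x = 0 \<longleftrightarrow> x = []"
  by (cases x rule: expand.cases) auto

lemma cd_deg_1_cases: "cd_deg x = Suc 0 \<Longrightarrow> x = [Cv]"
  by (cases x rule: expand.cases) auto

lemma cd_deg_2_cases: "cd_deg x = 2 \<Longrightarrow> x = [Cv, Cv] \<or> x = [Dv]"
  by (cases x rule: expand.cases) (auto dest: cd_deg_1_cases)

text \<open>The left-hand side is the coefficient of \<open>rev x\<close> in the cd-index of a Boolean algebra.\<close>
lemma partial_ge_pow2:
  "3 \<le> cd_deg x \<Longrightarrow> 2 ^ num_d x \<le> partial x (Suc (cd_deg x)) 0"
proof (induction x)
  case (Cons y x)
  let ?n = "cd_deg x"
  show ?case
  proof (cases y)
    case Cv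
    show ?thesis
    proof (cases "3 \<le> ?n")
      case True
      have "2 ^ num_d (y # x) \<le> partial x (Suc ?n) 0" using Cons True Cv by simp
      also have "\<dots> = coef (y # x) (Suc ?n) 0" using Cv by (simp add: partial_def del: sum.op_ivl_Suc)
      \<comment> \<open>A final c adds no power of 2, so the single summand at 0 suffices.\<close>
      also have "\<dots> \<le> (\<Sum>j=0..<Suc (Suc ?n). coef (y # x) (Suc ?n) j)"
        by (rule member_le_sum) (auto intro!: coef_nonneg simp del: coef.simps)
      finally show ?thesis using Cv by (simp add: partial_def)
    next
      case False
      \<comment> \<open>The bound fails for d alone, where the value is 1; the induction therefore
        starts from the explicit values in degree 3.\<close>
      then have "cd_deg x = 2" using Cons.prems Cv by simp
      then show ?thesis using Cv cd_deg_2_cases[of x] by (auto simp: partial_def numeral_eq_Suc)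
    qed
  next
    case Dv
    show ?thesis
    proof (cases "3 \<le> ?n")
      case True
      \<comment> \<open>The indices 1 and 2 both lie strictly between 0 and the degree of
        \<open>y # x\<close>; their two summands provide the factor 2.\<close>
      have ge: "2 ^ num_d x \<le> coef (y # x) (Suc (Suc ?n)) j" if "j \<in> {1, 2}" for j
      proof -
        have "2 ^ num_d x \<le> partial x (Suc ?n) 0" using Cons True by simp
        also have "\<dots> \<le> coef (y # x) (Suc (Suc ?n)) j"
          using coef_D_ge[of "Suc (Suc ?n)" x j] that True by (auto simp: Dv coef_nonneg simp del: coef.simps)
        finally show ?thesis .
      qed
      have "2 ^ num_d (y # x) \<le> (\<Sum>j\<in>{1, 2}. coef (y # x) (Suc (Suc ?n)) j)"
        using ge[of 1] ge[of 2] Dv by (simp del: coef.simps)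
      also have "\<dots> \<le> partial (y # x) (Suc (Suc (Suc ?n))) 0"
        unfolding partial_def diff_Suc_1
        by (rule sum_mono2) (use True in \<open>auto intro!: coef_nonneg simp del: coef.simps\<close>)
      finally show ?thesis using Dv by simp
    next
      case False
      then have "cd_deg x = Suc 0 \<or> cd_deg x = 2" using Cons.prems Dv by auto
      then show ?thesis
        using Dv cd_deg_1_cases[of x] cd_deg_2_cases[of x]
        by (auto simp: partial_def numeral_eq_Suc lessThan_Suc)
    qed
  qed
qed simp

section \<open>Flag vectors of the spheres\<close>

text \<open>The faces of Gamma including the empty one, so that the family is closed under subsets:
  some vertex up to \<open>i\<close> is missing.\<close>

definition gam :: "nat \<Rightarrow> nat \<Rightarrow> nat set set" where
  "gam n i = {F. F \<subseteq> {0..n} \<and> \<not> {0..i} \<subseteq> F}"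

text \<open>The join of the boundaries of the simplices on \<open>{0..i}\<close> and
  \<open>{Suc i..n}\<close>, again with the empty face.\<close>

definition bdy :: "nat \<Rightarrow> nat \<Rightarrow> nat set set" where
  "bdy n i = {F. F \<subseteq> {0..n} \<and> \<not> {0..i} \<subseteq> F \<and> \<not> {Suc i..n} \<subseteq> F}"

lemma gamma_faces_eq: "i < n \<Longrightarrow> gamma_faces n i = gam n i - {{}}"
  by (fastforce simp: gamma_faces_def gam_def sigma_def)

text \<open>A ridge omits two vertices, and the facets of Gamma containing it are indexed by the
  omitted vertices up to \<open>i\<close>. It lies in exactly one facet when the other omitted
  vertex is beyond \<open>i\<close>.\<close>

lemma boundary_faces_eq:
  assumes "i < n"
  shows "boundary_faces n i = bdy n i - {{}}"
proof (intro equalityI subsetI)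
  fix F assume "F \<in> boundary_faces n i"
  then obtain R where F: "F \<in> gam n i" "F \<noteq> {}" and R: "F \<subseteq> R" "R \<subseteq> {0..n}" "card R = n - 1"
    "card {k. k \<le> i \<and> R \<subseteq> sigma n k} = 1"
    using assms by (auto simp: boundary_faces_def gamma_faces_eq gam_def)
  have "\<not> {Suc i..n} \<subseteq> R"
  proof
    assume *: "{Suc i..n} \<subseteq> R"
    have "{0..n} - R = {k. k \<le> i \<and> R \<subseteq> sigma n k}"
      using R(2) * assms by (auto simp: sigma_def not_less_eq_eq[symmetric])
    then have "card ({0..n} - R) = 1" using R(4) by simp
    then show False
      using R(2,3) assms by (simp add: card_Diff_subset finite_subset[OF R(2)])
  qed
  then show "F \<in> bdy n i - {{}}" using F R by (auto simp: bdy_def gam_def)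
next
  fix F assume F: "F \<in> bdy n i - {{}}"
  then obtain p q where pq: "p \<le> i" "p \<notin> F" "i < q" "q \<le> n" "q \<notin> F"
    unfolding bdy_def by (fastforce simp: subset_iff Suc_le_eq)
  define R where "R = {0..n} - {p, q}"
  have "F \<subseteq> R" "R \<in> gamma_faces n i" "F \<in> gamma_faces n i"
    using F pq assms by (auto simp: R_def gamma_faces_eq gam_def bdy_def)
  moreover have "card R = n - 1" using pq by (simp add: R_def card_Diff_subset)
  moreover have "{k. k \<le> i \<and> R \<subseteq> sigma n k} = {p}"
  proof -
    have "R \<subseteq> sigma n k \<longleftrightarrow> k = p" if "k \<le> i" for k
    proof -
      have "k \<in> {0..n}" "k \<noteq> q" using that pq assms by auto
      then show ?thesis unfolding R_def sigma_def by blast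
    qed
    then show ?thesis using pq by auto
  qed
  ultimately show "F \<in> boundary_faces n i" unfolding boundary_faces_def by auto
qed

lemma card_bdy_less:
  assumes "i < n" "F \<in> bdy n i"
  shows "card F < n"
proof -
  obtain p q where pq: "p \<notin> F" "q \<notin> F" "p \<le> i" "i < q" "q \<le> n" "F \<subseteq> {0..n}"
    using assms(2) unfolding bdy_def by (fastforce simp: subset_iff Suc_le_eq)
  then have "card F \<le> card ({0..n} - {p, q})" by (intro card_mono) auto
  also have "\<dots> = n - 1" using pq by (simp add: card_Diff_subset)
  finally show ?thesis using assms by simp
qed

lemma card_gam:
  assumes "i < n"
  shows "int (card {F \<in> gam n i. card F = t}) = over (Suc n) 0 t - over (Suc n) (Suc i) t"
proof -
  let ?A = "\<lambda>B. {F. F \<subseteq> {0..n} \<and> B \<subseteq> F \<and> card F = t}"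
  have fin: "finite (?A B)" for B by (rule finite_subset[of _ "Pow {0..n}"]) auto
  have "{F \<in> gam n i. card F = t} = ?A {} - ?A {0..i}" by (auto simp: gam_def)
  moreover have "?A {0..i} \<subseteq> ?A {}" by auto
  ultimately have "int (card {F \<in> gam n i. card F = t}) = int (card (?A {})) - int (card (?A {0..i}))"
    using fin[of "{}"] fin[of "{0..i}"] by (simp add: card_Diff_subset of_nat_diff card_mono)
  then show ?thesis
    using card_over[of "{0..n}" "{}" t] card_over[of "{0..n}" "{0..i}" t] assms by simp
qed

text \<open>Inclusion-exclusion over the two blocks of vertices; a set containing both blocks is the
  whole vertex set, whose size exceeds \<open>t\<close>.\<close>

lemma card_bdy:
  assumes "i < n" "t < n"
  shows "int (card {F \<in> bdy n i. card F = t}) =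
     over (Suc n) 0 t - over (Suc n) (Suc i) t - over (Suc n) (n - i) t"
proof -
  let ?A = "\<lambda>B. {F. F \<subseteq> {0..n} \<and> B \<subseteq> F \<and> card F = t}"
  have fin: "finite (?A B)" for B by (rule finite_subset[of _ "Pow {0..n}"]) auto
  have "?A {0..i} \<inter> ?A {Suc i..n} = {}"
  proof -
    have "F = {0..n}" if "F \<subseteq> {0..n}" "{0..i} \<subseteq> F" "{Suc i..n} \<subseteq> F" for F
    proof (intro equalityI subsetI)
      fix x assume "x \<in> {0..n}"
      then show "x \<in> F" using that(2,3) by (cases "x \<le> i") auto
    qed (use that in auto)
    moreover have "card {0..n} \<noteq> t" using assms by simp
    ultimately show ?thesis by blast
  qed
  then have "card (?A {0..i} \<union> ?A {Suc i..n}) = card (?A {0..i}) + card (?A {Suc i..n})"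
    using fin by (intro card_Un_disjoint)
  moreover have "{F \<in> bdy n i. card F = t} = ?A {} - (?A {0..i} \<union> ?A {Suc i..n})"
    by (auto simp: bdy_def)
  moreover have sub: "?A {0..i} \<union> ?A {Suc i..n} \<subseteq> ?A {}" by auto
  moreover have "finite (?A {0..i} \<union> ?A {Suc i..n})" using fin by blast
  moreover note card_mono[OF fin sub]
  ultimately have "int (card {F \<in> bdy n i. card F = t}) =
      int (card (?A {})) - int (card (?A {0..i})) - int (card (?A {Suc i..n}))"
    by (simp only: card_Diff_subset of_nat_diff of_nat_add diff_diff_eq)
  then show ?thesis
    using card_over[of "{0..n}" "{}" t] card_over[of "{0..n}" "{0..i}" t]
      card_over[of "{0..n}" "{Suc i..n}" t] assms by simp
qed

section \<open>Chains in the face poset\<close>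

abbreviation lam_f :: "nat \<Rightarrow> nat \<Rightarrow> nat set \<Rightarrow> nat" where
  "lam_f n i \<equiv> flagf (lam_carrier n i) (lam_le n i) (lam_rk n) Bot Top"

text \<open>The faces in a chain through \<open>Tau\<close> are boundary faces and have rank below
  \<open>n\<close>, so \<open>Tau\<close> alone accounts for the rank \<open>n\<close>.\<close>

lemma lam_chains:
  assumes i: "i < n" and T: "T \<subseteq> {1..n}"
  shows "{C. C \<subseteq> lam_carrier n i - {Bot, Top} \<and>
      (\<forall>x\<in>C. \<forall>y\<in>C. lam_le n i x y \<or> lam_le n i y x) \<and> lam_rk n ` C = T} =
    image Face ` chains (gam n i) T \<union>
    (if n \<in> T then (\<lambda>C. insert Tau (Face ` C)) ` chains (bdy n i) (T - {n}) else {})"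
    (is "?L = ?R")
proof (intro equalityI subsetI)
  fix C assume C: "C \<in> ?L"
  define D where "D = {F. Face F \<in> C}"
  have CD: "C - {Tau} = Face ` D"
    using C by (auto simp: D_def lam_carrier_def)
  have D: "D \<subseteq> gam n i - {{}}"
    using C i by (auto simp: D_def lam_carrier_def gamma_faces_eq)
  have ch: "F \<subseteq> G \<or> G \<subseteq> F" if "F \<in> D" "G \<in> D" for F G
  proof -
    have "lam_le n i (Face F) (Face G) \<or> lam_le n i (Face G) (Face F)"
      using C that unfolding D_def by blast
    then show ?thesis unfolding lam_le_def by blast
  qed
  have rk: "lam_rk n ` (Face ` D) = card ` D"
    by (auto simp: lam_rk_def image_iff)
  show "C \<in> ?R"
  proof (cases "Tau \<in> C")
    case False
    then have "C = Face ` D" using CD by blast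
    have "card ` D = T" using C rk \<open>C = Face ` D\<close> by blast
    then have "D \<in> chains (gam n i) T" using D ch unfolding chains_def by blast
    then show ?thesis using \<open>C = Face ` D\<close> by blast
  next
    case True
    then have C': "C = insert Tau (Face ` D)" using CD by blast
    have b: "D \<subseteq> bdy n i"
    proof
      fix F assume "F \<in> D"
      then have "lam_le n i (Face F) Tau \<or> lam_le n i Tau (Face F)"
        using C True unfolding D_def by blast
      then show "F \<in> bdy n i" using boundary_faces_eq[OF i] by (auto simp: lam_le_def)
    qed
    have "card F < n" if "F \<in> D" for F
      using b that card_bdy_less[OF i] by auto
    moreover have "T = insert n (card ` D)"
    proof -
      have "T = lam_rk n ` insert Tau (Face ` D)" using C C' by blast
      then show ?thesis by (simp add: rk lam_rk_def image_image)
    qed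
    ultimately have "card ` D = T - {n}" "n \<in> T" by auto
    then have "D \<in> chains (bdy n i) (T - {n})" "n \<in> T"
      using b ch unfolding chains_def by blast+
    then show ?thesis using C' by simp
  qed
next
  fix C assume C: "C \<in> ?R"
  have nz: "D \<subseteq> X - {{}}" if "D \<in> chains X S" "S \<subseteq> {1..n}" for D X S
  proof -
    have "{} \<notin> D"
    proof
      assume "{} \<in> D"
      then have "0 \<in> card ` D" by force
      moreover have "card ` D = S" using chainsD(3)[OF that(1)] .
      ultimately show False using that(2) by auto
    qed
    moreover have "D \<subseteq> X" using chainsD(1)[OF that(1)] .
    ultimately show ?thesis by blast
  qed
  have rk: "lam_rk n ` (Face ` D) = card ` D" for D
    by (auto simp: lam_rk_def image_iff)
  consider D where "D \<in> chains (gam n i) T" "C = Face ` D"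
    | D where "n \<in> T" "D \<in> chains (bdy n i) (T - {n})" "C = insert Tau (Face ` D)"
    using C by (auto split: if_splits)
  then show "C \<in> ?L"
  proof cases
    case 1
    have "C \<subseteq> lam_carrier n i - {Bot, Top}"
      using nz[OF 1(1) T] 1(2) i by (auto simp: lam_carrier_def gamma_faces_eq)
    moreover have "lam_le n i x y \<or> lam_le n i y x" if xy: "x \<in> C" "y \<in> C" for x y
    proof -
      obtain F G where FG: "x = Face F" "y = Face G" "F \<in> D" "G \<in> D"
        using xy unfolding 1(2) by (elim imageE)
      have "F \<subseteq> G \<or> G \<subseteq> F" using chainsD(2)[OF 1(1) FG(3,4)] .
      then show ?thesis unfolding lam_le_def FG(1,2) by blast
    qed
    moreover have "lam_rk n ` C = T" using chainsD(3)[OF 1(1)] by (simp add: 1(2) rk)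
    ultimately show ?thesis by (intro CollectI conjI ballI)
  next
    case 2
    have D: "D \<subseteq> bdy n i - {{}}" using nz[OF 2(2)] T by blast
    moreover have "bdy n i \<subseteq> gam n i" by (auto simp: bdy_def gam_def)
    ultimately have "C \<subseteq> lam_carrier n i - {Bot, Top}"
      using 2(3) i by (auto simp: lam_carrier_def gamma_faces_eq)
    moreover have "lam_le n i x y \<or> lam_le n i y x" if "x \<in> C" "y \<in> C" for x y
    proof -
      have bd: "D \<subseteq> boundary_faces n i" using D boundary_faces_eq[OF i] by simp
      have tau: "lam_le n i (Face F) Tau" if "F \<in> D" for F
        using bd that by (auto simp: lam_le_def)
      have face: "lam_le n i (Face F) (Face G) \<or> lam_le n i (Face G) (Face F)" if "F \<in> D" "G \<in> D" for F G
        using chainsD(2)[OF 2(2) that] by (auto simp: lam_le_def)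
      have refl: "lam_le n i Tau Tau" by (simp add: lam_le_def)
      from that show ?thesis unfolding 2(3) by (elim insertE imageE) (simp_all only: tau face refl simp_thms)
    qed
    moreover have "lam_rk n ` C = T"
    proof -
      have "lam_rk n ` C = insert n (card ` D)" by (simp add: 2(3) rk lam_rk_def image_image)
      moreover have "card ` D = T - {n}" using chainsD(3)[OF 2(2)] .
      ultimately show ?thesis using 2(1) by auto
    qed
    ultimately show ?thesis by (intro CollectI conjI ballI)
  qed
qed

lemma lam_f_eq:
  assumes i: "i < n" and T: "T \<subseteq> {1..n}"
  shows "int (lam_f n i T) =
    int (below_count T) * (over (Suc n) 0 (mx T) - over (Suc n) (Suc i) (mx T)) +
    (if n \<in> T then int (below_count (T - {n})) * (over (Suc n) 0 (mx (T - {n})) -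
       over (Suc n) (Suc i) (mx (T - {n})) - over (Suc n) (n - i) (mx (T - {n}))) else 0)"
proof -
  have fT: "finite T" using T by (rule finite_subset) simp
  have T0: "0 \<notin> T" using T by (metis atLeastAtMost_iff not_one_le_zero subsetD)
  have mx: "mx (T - {n}) < n"
  proof (cases "T - {n} = {}")
    case False
    then have "Max (T - {n}) \<in> T - {n}" using fT by (intro Max_in) auto
    then have "Max (T - {n}) \<in> {1..n} - {n}" using T by blast
    then have "Max (T - {n}) < n" by simp
    with False show ?thesis by (simp only: mx_def if_False)
  qed (use i in \<open>simp add: mx_def\<close>)
  have inj: "inj_on (image Face) A" "inj_on (\<lambda>C. insert Tau (Face ` C)) A" for A
    by (rule inj_on_inverseI[where g = "\<lambda>C. {F. Face F \<in> C}"], auto)+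
  have fin: "finite (gam n i)" "finite (bdy n i)"
    by (rule finite_subset[of _ "Pow {0..n}"]; auto simp: gam_def bdy_def)+
  have g: "card (chains (gam n i) T) = below_count T * card {F \<in> gam n i. card F = mx T}"
    by (rule card_chains[OF fT T0 fin(1)]) (auto simp: gam_def intro: finite_subset[of _ "{0..n}"])
  have b: "card (chains (bdy n i) (T - {n})) =
      below_count (T - {n}) * card {F \<in> bdy n i. card F = mx (T - {n})}"
    by (rule card_chains[OF _ _ fin(2)]) (use i fT T0 in \<open>auto simp: bdy_def intro: finite_subset[of _ "{0..n}"]\<close>)
  have disj: "image Face ` A \<inter> (\<lambda>C. insert Tau (Face ` C)) ` B = {}" for A B
    by auto
  have "card (image Face ` chains (gam n i) T \<union>
      (\<lambda>C. insert Tau (Face ` C)) ` chains (bdy n i) (T - {n})) =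
    card (chains (gam n i) T) + card (chains (bdy n i) (T - {n}))"
    using card_Un_disjoint[OF finite_imageI finite_imageI disj] finite_chains fin
    by (simp only: card_image[OF inj(1)] card_image[OF inj(2)])
  then have "lam_f n i T = card (chains (gam n i) T) +
     (if n \<in> T then card (chains (bdy n i) (T - {n})) else 0)"
    unfolding flagf_def lam_chains[OF i T] by (simp add: card_image[OF inj(1)])
  then show ?thesis
    by (simp only: g b of_nat_add of_nat_mult of_nat_0 if_distrib[of int] card_gam[OF i] card_bdy[OF i mx])
qed

section \<open>Flag h-vectors and identification of the cd-index\<close>

abbreviation lam_h :: "nat \<Rightarrow> nat \<Rightarrow> nat set \<Rightarrow> int" where
  "lam_h n i \<equiv> flagh (lam_carrier n i) (lam_le n i) (lam_rk n) Bot Top"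

text \<open>The rank \<open>n\<close> does not occur, so only chains in Gamma count, and
  \<open>over_telescope\<close> splits their number into the terms for k up to
  \<open>i\<close>.\<close>

lemma lam_h_A:
  assumes i: "i < Suc (length r)"
  shows "lam_h (Suc (length r)) i (bset (Av # r)) = (\<Sum>k\<le>i. desc r k)"
proof -
  let ?n = "Suc (length r)"
  have "lam_h ?n i (bset r) = altsum (bset r) (\<lambda>t. over (Suc ?n) 0 t - over (Suc ?n) (Suc i) t)"
    unfolding flagh_def altsum_def
    by (intro sum.cong refl) (use bset_subset[of r] in \<open>subst lam_f_eq[OF i]; force\<close>)
  also have "\<dots> = altsum (bset r) (\<lambda>t. \<Sum>k\<le>i. over ?n k t)"
    using over_telescope[of 0 "Suc i" ?n] i
    by (simp add: atLeast0LessThan lessThan_Suc_atMost del: sum.op_ivl_Suc sum.lessThan_Suc)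
  finally show ?thesis by (simp add: altsum_sum desc_def)
qed

text \<open>Chains ending in a facet of Gamma give the multiple of \<open>over n 0\<close>. The
  chains through \<open>Tau\<close> minus those in Gamma without rank \<open>n\<close> leave minus
  the count \<open>over (Suc n) (n - i)\<close> of the interior faces.\<close>

lemma lam_h_B:
  assumes i: "i < Suc (length r)"
  shows "lam_h (Suc (length r)) i (bset (Bv # r)) =
    (\<Sum>k\<le>i. desc r 0 - desc r (Suc (length r) - k))"
proof -
  let ?n = "Suc (length r)" and ?S = "bset r"
  have S: "finite ?S" "?n \<notin> ?S" using bset_subset[of r] by auto
  have "lam_h ?n i (insert ?n ?S) = (\<Sum>T\<in>Pow ?S. (- 1) ^ card (?S - T) *
      (int (lam_f ?n i (insert ?n T)) - int (lam_f ?n i T)))"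
    unfolding flagh_def using S by (rule alternating_sum_insert)
  also have "\<dots> = altsum ?S (\<lambda>t. int (Suc i) * over ?n 0 t - over (Suc ?n) (?n - i) t)"
    unfolding altsum_def
  proof (intro sum.cong refl arg_cong2[where f = "(*)"])
    fix T assume "T \<in> Pow ?S"
    then have TS: "T \<subseteq> ?S" "T \<subseteq> {1..length r}" using bset_subset[of r] by blast+
    have T: "finite T" "0 \<notin> T" "\<And>t. t \<in> T \<Longrightarrow> t < ?n" "?n \<notin> T"
      using finite_subset[OF TS(1) S(1)] TS(2) by (auto dest!: subsetD)
    have sub: "T \<subseteq> {1..?n}" "insert ?n T \<subseteq> {1..?n}" using TS(2) by auto
    \<comment> \<open>This is the number of facets of Gamma.\<close>
    have top: "over (Suc ?n) 0 ?n - over (Suc ?n) (Suc i) ?n = int (Suc i)"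
      using i by (simp add: over_def Suc_diff_le)
    have "int (lam_f ?n i (insert ?n T)) = int (below_count T) * over ?n 0 (mx T) * int (Suc i) +
       int (below_count T) * (over (Suc ?n) 0 (mx T) - over (Suc ?n) (Suc i) (mx T) - over (Suc ?n) (?n - i) (mx T))"
      using lam_f_eq[OF i sub(2)]
      by (simp only: mx_insert[OF T(1,3)] below_count_insert[OF T(1-3)] Diff_insert_absorb[OF T(4)]
          top over_0[of ?n] insertI1 if_True of_nat_mult mult.assoc)
    moreover have "int (lam_f ?n i T) = int (below_count T) * (over (Suc ?n) 0 (mx T) - over (Suc ?n) (Suc i) (mx T))"
      using lam_f_eq[OF i sub(1)] T(4) by simp
    ultimately show "int (lam_f ?n i (insert ?n T)) - int (lam_f ?n i T) =
        int (below_count T) * (int (Suc i) * over ?n 0 (mx T) - over (Suc ?n) (?n - i) (mx T))"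
      by (simp add: algebra_simps)
  qed
  also have "\<dots> = altsum ?S (\<lambda>t. int (Suc i) * over ?n 0 t - (\<Sum>k\<le>i. over ?n (?n - k) t))"
  proof (intro altsum_cong arg_cong2[where f = "(-)"] refl)
    fix T assume "T \<subseteq> ?S"
    then have "over (Suc ?n) (?n - i) (mx T) = (\<Sum>k=?n - i..<Suc ?n. over ?n k (mx T))"
      using mx_le[of T r] by (intro over_sum) auto
    also have "\<dots> = (\<Sum>k\<le>i. over ?n (?n - k) (mx T))"
      by (rule sum.reindex_bij_witness[of _ "\<lambda>k. ?n - k" "\<lambda>k. ?n - k"]) (use i in auto)
    finally show "over (Suc ?n) (?n - i) (mx T) = (\<Sum>k\<le>i. over ?n (?n - k) (mx T))" .
  qed
  also have "\<dots> = int (Suc i) * desc r 0 - (\<Sum>k\<le>i. desc r (?n - k))"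
    by (simp only: altsum_diff altsum_mult altsum_sum desc_def)
  finally show ?thesis by (simp add: sum_subtractf)
qed

text \<open>By \<open>cd_index_eqI\<close> it suffices to compare ab-coefficients; the last letter
  of \<open>v\<close> decides between \<open>lam_h_A\<close> and \<open>lam_h_B\<close>.\<close>

lemma Phi_Lambda_eq:
  assumes i: "i < n"
  shows "Phi_Lambda n i = (\<lambda>w. \<Sum>k\<le>i. coef (rev w) n k)"
  unfolding Phi_Lambda_def
proof (rule cd_index_eqI)
  have deg: "cd_deg w = n" if "(\<Sum>k\<le>i. coef (rev w) n k) \<noteq> 0" for w
    using that coef_deg[of "rev w" n] by (metis (no_types, lifting) cd_deg_simps(4) sum.neutral)
  then show "finite {w. (\<Sum>k\<le>i. coef (rev w) n k) \<noteq> 0}"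
    by (intro finite_subset[OF _ finite_cd_deg[of n]]) auto
  fix v
  have inj: "inj_on rev A" for A :: "cdvar list set" by (simp add: inj_on_def)
  have sum: "(\<Sum>w\<in>cdwords v. \<Sum>k\<le>i. coef (rev w) n k) = (\<Sum>k\<le>i. ab_coef (rev v) n k)"
    unfolding ab_coef_def cdwords_rev by (subst sum.swap) (simp add: sum.reindex inj)
  show "abindex n (lam_h n i) v = (\<Sum>w\<in>cdwords v. \<Sum>k\<le>i. coef (rev w) n k)"
  proof (cases "length v = n")
    case False
    then have "(\<Sum>w\<in>cdwords v. \<Sum>k\<le>i. coef (rev w) n k) = 0"
      using deg length_expand by (intro sum.neutral) blast
    with False show ?thesis by (simp add: abindex_def)
  next
    case True
    then obtain x r where r: "rev v = x # r" "n = Suc (length r)"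
      using i by (metis length_rev length_Suc_conv less_imp_Suc_add)
    have "abindex n (lam_h n i) v = lam_h n i (bset (rev v))"
      using True bset_rev[of v] by (simp add: abindex_def)
    also have "\<dots> = (\<Sum>k\<le>i. ab_coef (rev v) n k)"
    proof (cases x)
      case Av
      have "(\<Sum>k\<le>i. ab_coef (rev v) n k) = (\<Sum>k\<le>i. desc r k)"
        unfolding r Av by (intro sum.cong ab_coef_desc(1)) (use i r in auto)
      then show ?thesis using lam_h_A[of i r] i r Av by simp
    next
      case Bv
      have "(\<Sum>k\<le>i. ab_coef (rev v) n k) = (\<Sum>k\<le>i. desc r 0 - desc r (n - k))"
        unfolding r Bv by (intro sum.cong ab_coef_desc(2)) (use i r in auto)
      then show ?thesis using lam_h_B[of i r] i r Bv by simp
    qed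
    finally show ?thesis using sum by simp
  qed
qed

lemma checkPhi_eq:
  assumes "i < n"
  shows "checkPhi n i w = coef (rev w) n i"
proof (cases i)
  case (Suc j)
  then have "i \<le> n - 1" "j < n" using assms by auto
  with Suc show ?thesis using assms by (simp add: checkPhi_def Phi_Lambda_eq)
qed (use assms in \<open>simp add: checkPhi_def Phi_Lambda_eq\<close>)

theorem theorem4p1:
  fixes n :: nat and w :: "cdvar list"
  assumes "n \<ge> 4"
  shows "(cd_deg w = n - 1 \<longrightarrow> checkPhi n 0 (w @ [Cv]) \<ge> 2 ^ num_d w)
       \<and> (\<forall>j. n \<ge> 5 \<and> 1 \<le> j \<and> j \<le> n - 1 \<and> cd_deg w = n - 2
            \<longrightarrow> checkPhi n j (w @ [Dv]) \<ge> 2 ^ num_d w)"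
proof (intro conjI allI impI)
  assume deg: "cd_deg w = n - 1"
  \<comment> \<open>The degree n - 1 is at least 3, and \<open>partial (rev w) n 0\<close> is the
    coefficient of w followed by c.\<close>
  have "2 ^ num_d (rev w) \<le> partial (rev w) n 0"
    using partial_ge_pow2[of "rev w"] deg assms by (simp add: numeral_eq_Suc)
  then show "2 ^ num_d w \<le> checkPhi n 0 (w @ [Cv])"
    using assms by (simp add: checkPhi_eq partial_def)
next
  fix j assume j: "n \<ge> 5 \<and> 1 \<le> j \<and> j \<le> n - 1 \<and> cd_deg w = n - 2"
  \<comment> \<open>Here \<open>n \<ge> 5\<close> ensures degree at least 3; this is the first claim
    in dimension n - 1.\<close>
  have "2 ^ num_d (rev w) \<le> partial (rev w) (Suc (cd_deg (rev w))) 0"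
    by (rule partial_ge_pow2) (use j in auto)
  also have "Suc (cd_deg (rev w)) = n - 1" using j by auto
  also have "partial (rev w) (n - 1) 0 \<le> coef (Dv # rev w) n j"
    by (rule coef_D_ge) (use j coef_nonneg in auto)
  finally show "2 ^ num_d w \<le> checkPhi n j (w @ [Dv])"
    using checkPhi_eq[of j n "w @ [Dv]"] j by (simp del: coef.simps) linarith
qed

end
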